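(* Let $n\ge2$, let $\Omega\subset\mathbb{R}^n$ be open, let $F\in C^1(\Omega\times G(n,n-1),\mathbb{R}_{>0})$ and let $x\in\Omega$. Define $G(x,\cdot):\mathbb{R}^n\to\mathbb{R}_{\ge0}$ by $$G(x,\lambda\nu):=|\lambda|\,F(x,\nu^\perp)\qquad\text{for all }\lambda\in\mathbb{R},\ \nu\in\mathbb S^{n-1}.$$ Then $F$ satisfies the atomic condition $(AC)$ at $x$ if and only if the function $G(x,\cdot)$ is strictly convex.
   Context: $G(n,n-1)$ is the Grassmannian of unoriented hyperplanes (through $0$) of $\mathbb{R}^n$; $\nu^\perp$ is the hyperplane orthogonal to $\nu$. A plane $T\in G(n,d)$ is identified with the matrix of the orthogonal projection onto $T$, so $G(n,d)$ is a smooth submanifold of $\mathbb{R}^n\otimes\mathbb{R}^n$ ($n\times n$ matrices); $T^\perp=\mathrm{Id}-T$. For matrices, $A:B=\langle A,B\rangle=\mathrm{tr}(A^*B)$. The matrix $B_F(x,T)\in\mathbb{R}^n\otimes\mathbb{R}^n$ is uniquely defined by $$B_F(x,T):L=F(x,T)\,(T:L)+\big\langle d_TF(x,T),\,T^\perp\circ L\circ T+(T^\perp\circ L\circ T)^*\big\rangle\quad\text{for all }L\in\mathbb{R}^n\otimes\mathbb{R}^n,$$ where $d_TF(x,T)$ is the differential of $F(x,\cdot)$ at $T$, acting on the tangent space $\mathrm{Tan}_TG(n,d)=\{S: S^*=S,\ T\circ S\circ T=0,\ T^\perp\circ S\circ T^\perp=0\}$. Atomic condition (with $d=n-1$). For a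 Borel probability measure $\mu\in\mathcal P(G(n,d))$ let $A_x(\mu)=\int_{G(n,d)}B_F(x,T)\,d\mu(T)$. $F$ satisfies $(AC)$ at $x$ if: (i) $\dim\mathrm{Ker}\,A_x(\mu)\le n-d$ for all $\mu\in\mathcal P(G(n,d))$; and (ii) if $\dim\mathrm{Ker}\,A_x(\mu)=n-d$, then $\mu=\delta_{T_0}$ for some $T_0\in G(n,d)$. Strict convexity. $G(x,\cdot)$ is even, positively one-homogeneous, and $C^1$ on $\mathbb{R}^n\setminus\{0\}$. Strict convexity of $G(x,\cdot)$ is meant in the sense appropriate to one-homogeneous functions (which are always linear along rays), namely $$G(x,\nu)>\langle d_\nu G(x,\bar\nu),\nu\rangle\qquad\text{for all }\bar\nu,\nu\in\mathbb S^{n-1}\text{ with }\nu\neq\pm\bar\nu.$$ *)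

theory Defs
  imports "HOL-Probability.Probability"
begin

text \<open>The matrix of the orthogonal projection onto a subspace; planes are identified with these.\<close>

definition is_orth_proj :: "(real^'n) set \<Rightarrow> real^'n^'n \<Rightarrow> bool" where
  "is_orth_proj V T \<longleftrightarrow> (\<forall>v. T *v v \<in> V \<and> (\<forall>w\<in>V. orthogonal (v - T *v v) w))"

definition orth_proj :: "(real^'n) set \<Rightarrow> real^'n^'n" where
  "orth_proj V = (THE T. is_orth_proj V T)"

lemma is_orth_proj_unique:
  assumes V: "subspace V" and S: "is_orth_proj V S" and T: "is_orth_proj V T"
  shows "S = T"
proof -
  have "S *v v = T *v v" for v
  proof -
    let ?d = "S *v v - T *v v"
    have "?d \<in> V"
      using V S T by (simp add: is_orth_proj_def subspace_diff)
    then have "(v - T *v v) \<bullet> ?d = 0" "(v - S *v v) \<bullet> ?d = 0"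
      using S T by (auto simp: is_orth_proj_def orthogonal_def)
    then have "?d \<bullet> ?d = 0"
      by (simp add: inner_diff_left)
    then show ?thesis by simp
  qed
  then show ?thesis
    by (simp add: matrix_eq)
qed

lemma is_orth_proj_ex:
  assumes V: "subspace (V :: (real^'n) set)"
  shows "\<exists>T. is_orth_proj V T"
proof -
  have "\<exists>y. y \<in> V \<and> (\<forall>w\<in>V. orthogonal (v - y) w)" for v :: "real^'n"
  proof -
    obtain y z where "y \<in> span V" "\<And>w. w \<in> span V \<Longrightarrow> orthogonal z w" "v = y + z"
      using orthogonal_subspace_decomp_exists[of V v] by metis
    then show ?thesis
      using V by (intro exI[of _ y]) (auto simp: span_eq_iff[THEN iffD2])
  qed
  then obtain p where p: "\<And>v. p v \<in> V" "\<And>v w. w \<in> V \<Longrightarrow> (v - p v) \<bullet> w = 0"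
    unfolding orthogonal_def by metis
  have uniq: "p v = y" if "y \<in> V" "\<And>w. w \<in> V \<Longrightarrow> (v - y) \<bullet> w = 0" for v y
  proof -
    have "p v - y \<in> V" using V p(1) that(1) by (rule subspace_diff)
    then have "(p v - y) \<bullet> (p v - y) = 0"
      using p(2)[of "p v - y" v] that(2)[of "p v - y"] by (simp add: inner_diff_left)
    then show ?thesis by simp
  qed
  have "linear p"
  proof
    show "p (a + b) = p a + p b" for a b
      using p(2)[of _ a] p(2)[of _ b]
      by (intro uniq) (auto simp: V p(1) subspace_add inner_diff_left inner_add_left)
    show "p (r *\<^sub>R a) = r *\<^sub>R p a" for r a
      using p(2)[of _ a]
      by (intro uniq) (auto simp: V p(1) subspace_scale inner_diff_left)
  qed
  then have "is_orth_proj V (matrix p)"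
    using p by (simp add: is_orth_proj_def orthogonal_def)
  then show ?thesis ..
qed

lemma is_orth_proj_orth_proj:
  assumes "subspace V"
  shows "is_orth_proj V (orth_proj V)"
  unfolding orth_proj_def
  using is_orth_proj_ex[OF assms] is_orth_proj_unique[OF assms] by (metis theI)

definition grassmannian :: "nat \<Rightarrow> (real^'n^'n) set" where
  "grassmannian d = orth_proj ` {V. subspace V \<and> dim V = d}"

definition perp_hyperplane :: "real^'n \<Rightarrow> real^'n^'n" where
  "perp_hyperplane \<nu> = orth_proj {w. orthogonal \<nu> w}"

text \<open>The matrix pairing \<open>A : B\<close> is the inner product of the nested vector type.\<close>

lemma inner_matrix_eq_trace:
  fixes A B :: "real^'n^'n"
  shows "A \<bullet> B = trace (transpose A ** B)"
  unfolding inner_vec_def trace_def transpose_def matrix_matrix_mult_def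
  by (simp add: sum.swap[of "\<lambda>i j. A $ i $ j * B $ i $ j"])

text \<open>\<open>C\<^sup>1\<close> functions on an open set, and on an embedded submanifold (which need not be
  open in the ambient space), where \<open>C\<^sup>1\<close> means local extendability to a \<open>C\<^sup>1\<close> function.\<close>

definition C1_on_open :: "'a::real_normed_vector set \<Rightarrow> ('a \<Rightarrow> 'b::real_normed_vector) \<Rightarrow> bool" where
  "C1_on_open U g \<longleftrightarrow>
    (\<exists>g'. (\<forall>p\<in>U. (g has_derivative blinfun_apply (g' p)) (at p)) \<and> continuous_on U g')"

definition C1_on_submanifold :: "'a::real_normed_vector set \<Rightarrow> ('a \<Rightarrow> 'b::real_normed_vector) \<Rightarrow> bool" where
  "C1_on_submanifold M f \<longleftrightarrow>
    (\<forall>p\<in>M. \<exists>U g. open U \<and> p \<in> U \<and> C1_on_open U g \<and> (\<forall>q\<in>M \<inter> U. f q = g q))"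

text \<open>The differential along the Grassmannian is the derivative at \<open>T\<close> relative to the
  Grassmannian. As a linear map on the ambient matrix space this derivative is not unique, but all
  choices agree on the tangent space
  \<open>{S. S\<^sup>* = S, T S T = 0, T\<^sup>\<bottom> S T\<^sup>\<bottom> = 0}\<close>, and in \<open>B_matrix\<close> it is only
  applied to \<open>T\<^sup>\<bottom> L T + (T\<^sup>\<bottom> L T)\<^sup>*\<close>, which lies in that space.\<close>

definition grass_differential :: "nat \<Rightarrow> (real^'n^'n \<Rightarrow> real) \<Rightarrow> real^'n^'n \<Rightarrow> real^'n^'n \<Rightarrow> real" where
  "grass_differential d f T = frechet_derivative f (at T within grassmannian d)"

definition B_matrix ::
  "nat \<Rightarrow> (real^'n \<Rightarrow> real^'n^'n \<Rightarrow> real) \<Rightarrow> real^'n \<Rightarrow> real^'n^'n \<Rightarrow> real^'n^'n" where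
  "B_matrix d F x T = (THE B. \<forall>L. B \<bullet> L =
     F x T * (T \<bullet> L) +
     grass_differential d (F x) T
       ((mat 1 - T) ** L ** T + transpose ((mat 1 - T) ** L ** T)))"

definition borel_grassmannian :: "nat \<Rightarrow> (real^'n^'n) measure" where
  "borel_grassmannian d = restrict_space borel (grassmannian d)"

definition grass_probs :: "nat \<Rightarrow> (real^'n^'n) measure set" where
  "grass_probs d = {\<mu>. prob_space \<mu> \<and> sets \<mu> = sets (borel_grassmannian d)}"

definition A_matrix ::
  "nat \<Rightarrow> (real^'n \<Rightarrow> real^'n^'n \<Rightarrow> real) \<Rightarrow> real^'n \<Rightarrow> (real^'n^'n) measure \<Rightarrow> real^'n^'n" where
  "A_matrix d F x \<mu> = (\<integral>T. B_matrix d F x T \<partial>\<mu>)"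

definition matrix_kernel :: "real^'n^'m \<Rightarrow> (real^'n) set" where
  "matrix_kernel A = {v. A *v v = 0}"

definition atomic_condition ::
  "nat \<Rightarrow> (real^'n \<Rightarrow> real^'n^'n \<Rightarrow> real) \<Rightarrow> real^'n \<Rightarrow> bool" where
  "atomic_condition d F x \<longleftrightarrow>
    (\<forall>\<mu>\<in>grass_probs d. dim (matrix_kernel (A_matrix d F x \<mu>)) \<le> CARD('n) - d) \<and>
    (\<forall>\<mu>\<in>grass_probs d. dim (matrix_kernel (A_matrix d F x \<mu>)) = CARD('n) - d \<longrightarrow>
       (\<exists>T0\<in>grassmannian d. \<mu> = return (borel_grassmannian d) T0))"

text \<open>Strict convexity for one-homogeneous functions, which are always linear along rays.\<close>

definition strictly_convex_homogeneous :: "(real^'n \<Rightarrow> real) \<Rightarrow> bool" where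
  "strictly_convex_homogeneous g \<longleftrightarrow>
    (\<forall>\<nu>' \<nu>. norm \<nu>' = 1 \<and> norm \<nu> = 1 \<and> \<nu> \<noteq> \<nu>' \<and> \<nu> \<noteq> - \<nu>' \<longrightarrow>
       g \<nu> > frechet_derivative g (at \<nu>') \<nu>)"

end

(*
  Write g = G x. Differentiating T = Id - nu (x) nu along the sphere gives
  B_F(x,T) = g(nu) Id - nu (x) grad g(nu).

  If g is strictly convex and A(mu) v = 0 for a unit vector v, pair with grad g(v):
  the integral of g(nu) g(v) - (grad g(nu) . v) (grad g(v) . nu) vanishes, although the integrand
  is positive unless nu = v or nu = -v. Hence mu is the Dirac mass at the hyperplane orthogonal to v.

  If g is not strictly convex, some gradient satisfies grad g(nu) = M grad g(u) with nu, u
  independent. Then M nu + u lies in the kernel of A(mu) for mu the average of the Dirac masses at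
  the two orthogonal hyperplanes, which contradicts the atomic condition.
*)
theory Submission
  imports Defs
begin

section \<open>Rank-one matrices\<close>

definition outer :: "real^'m \<Rightarrow> real^'n \<Rightarrow> real^'n^'m" where
  "outer a b = (\<chi> i j. a $ i * b $ j)"

lemma outer_mult_vec: "outer a b *v w = (b \<bullet> w) *\<^sub>R a"
  by (simp add: outer_def matrix_vector_mult_def inner_vec_def vec_eq_iff sum_distrib_left mult_ac)

lemma transpose_outer: "transpose (outer a b) = outer b a"
  by (simp add: outer_def transpose_def mult.commute)

lemma outer_mult_matrix: "outer a b ** A = outer a (transpose A *v b)"
  by (simp add: outer_def matrix_matrix_mult_def matrix_vector_mult_def transpose_def vec_eq_iff
      sum_distrib_left mult_ac)

lemma inner_outer: "outer a b \<bullet> L = a \<bullet> (L *v b)"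
  by (simp add: outer_def inner_vec_def matrix_vector_mult_def sum_distrib_left mult_ac)

lemma inner_matrix_vector: "a \<bullet> (L *v b) = (transpose L *v a) \<bullet> (b :: real^'n)"
  for L :: "real^'n^'m"
  by (metis dot_lmul_matrix vector_transpose_matrix transpose_transpose)

lemma bounded_bilinear_outer:
  "bounded_bilinear (outer :: real^'m \<Rightarrow> real^'n \<Rightarrow> real^'n^'m)"
  unfolding bilinear_conv_bounded_bilinear[symmetric] bilinear_def
  by (auto intro!: linearI simp: outer_def vec_eq_iff algebra_simps)

section \<open>Hyperplanes described by unit normals\<close>

lemma perp_hyperplane_eq:
  fixes \<nu> :: "real^'n"
  assumes "norm \<nu> = 1"
  shows "perp_hyperplane \<nu> = mat 1 - outer \<nu> \<nu>"
proof -
  let ?V = "{w. orthogonal \<nu> w}"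
  have "subspace ?V"
    by (simp add: orthogonal_def subspace_hyperplane)
  moreover have "is_orth_proj ?V (mat 1 - outer \<nu> \<nu>)"
    using assms
    by (auto simp: is_orth_proj_def orthogonal_def algebra_simps outer_mult_vec dot_square_norm)
  ultimately show ?thesis
    unfolding perp_hyperplane_def using is_orth_proj_orth_proj is_orth_proj_unique by blast
qed

lemma perp_hyperplane_mult_vec:
  "norm \<nu> = 1 \<Longrightarrow> perp_hyperplane \<nu> *v w = w - (\<nu> \<bullet> w) *\<^sub>R \<nu>"
  by (simp add: perp_hyperplane_eq matrix_vector_mult_diff_rdistrib outer_mult_vec)

text \<open>The kernel of the projection is the line of normals, and a line contains exactly two
  unit vectors.\<close>

lemma perp_hyperplane_eqD:
  assumes "norm \<nu> = 1" "norm \<nu>' = 1" "perp_hyperplane \<nu> = perp_hyperplane \<nu>'"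
  shows "\<nu> = \<nu>' \<or> \<nu> = - \<nu>'"
proof -
  have "perp_hyperplane \<nu>' *v \<nu> = 0"
    using assms perp_hyperplane_mult_vec[of \<nu> \<nu>] by (simp add: dot_square_norm)
  then have *: "\<nu> = (\<nu>' \<bullet> \<nu>) *\<^sub>R \<nu>'"
    using perp_hyperplane_mult_vec[OF assms(2)] by simp
  then have "\<bar>\<nu>' \<bullet> \<nu>\<bar> = 1"
    using assms by (metis mult.right_neutral norm_scaleR)
  then show ?thesis
    using * by (metis abs_eq_iff abs_one scaleR_minus1_left scaleR_one)
qed

lemma perp_hyperplane_uminus:
  "norm \<nu> = 1 \<Longrightarrow> perp_hyperplane (- \<nu>) = perp_hyperplane \<nu>"
  by (simp add: perp_hyperplane_eq outer_def)

text \<open>The codimension-one Grassmannian parametrised by the unit sphere; this form makes both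
  its compactness and differentiation along it accessible.\<close>

definition hyperplanes :: "(real^'n^'n) set" where
  "hyperplanes = perp_hyperplane ` {\<nu>. norm \<nu> = 1}"

lemma perp_hyperplane_in: "norm \<nu> = 1 \<Longrightarrow> perp_hyperplane \<nu> \<in> hyperplanes"
  by (auto simp: hyperplanes_def)

lemma hyperplanes_cases:
  assumes "T \<in> hyperplanes"
  obtains \<nu> where "norm \<nu> = 1" "T = perp_hyperplane \<nu>"
  using assms by (auto simp: hyperplanes_def)

text \<open>A proper subspace lies in the orthogonal complement of some nonzero \<open>a\<close>;
  for dimension \<open>CARD('n) - 1\<close> equal dimensions force equality.\<close>

lemma grassmannian_eq_hyperplanes:
  "grassmannian (CARD('n) - 1) = (hyperplanes :: (real^'n^'n) set)"
proof -
  have dim: "dim {w. orthogonal \<nu> w} = CARD('n) - 1" if "norm \<nu> = 1" for \<nu> :: "real^'n"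
  proof -
    from that have "\<nu> \<noteq> 0" by auto
    then show ?thesis by (simp add: orthogonal_def dim_hyperplane)
  qed
  have "\<exists>\<nu>. norm \<nu> = 1 \<and> V = {w. orthogonal \<nu> w}"
    if V: "subspace V" "dim V = CARD('n) - 1" for V :: "(real^'n) set"
  proof -
    have "dim V < DIM(real^'n)"
      using V by simp
    then obtain a where a: "a \<noteq> 0" "span V \<subseteq> {x. a \<bullet> x = 0}"
      using lowdim_subset_hyperplane by blast
    have "sgn a \<bullet> w = 0 \<longleftrightarrow> a \<bullet> w = 0" for w
      using a(1) by (simp add: sgn_div_norm)
    then have "V \<subseteq> {w. orthogonal (sgn a) w}"
      using a(2) span_superset[of V] by (auto simp: orthogonal_def)
    moreover have "norm (sgn a) = 1"
      using a(1) by (simp add: norm_sgn)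
    moreover from this have "subspace {w. orthogonal (sgn a) w}" "dim {w. orthogonal (sgn a) w} \<le> dim V"
      using dim[of "sgn a"] V(2) by (auto simp: orthogonal_def subspace_hyperplane)
    ultimately show ?thesis
      using subspace_dim_equal[OF V(1)] by blast
  qed
  moreover have "subspace {w. orthogonal \<nu> w}" for \<nu> :: "real^'n"
    by (simp add: orthogonal_def subspace_hyperplane)
  ultimately have "{V. subspace V \<and> dim V = CARD('n) - 1} = (\<lambda>\<nu>::real^'n. {w. orthogonal \<nu> w}) ` {\<nu>. norm \<nu> = 1}"
    using dim by blast
  then show ?thesis
    unfolding grassmannian_def hyperplanes_def perp_hyperplane_def by (simp only: image_image)
qed

lemma continuous_on_perp_hyperplane:
  "continuous_on {\<nu>::real^'n. norm \<nu> = 1} perp_hyperplane"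
proof -
  have "continuous_on {\<nu>::real^'n. norm \<nu> = 1} (\<lambda>\<nu>. mat 1 - outer \<nu> \<nu>)"
    by (intro continuous_intros bounded_bilinear.continuous_on[OF bounded_bilinear_outer])
  then show ?thesis
    by (rule continuous_on_eq) (simp add: perp_hyperplane_eq)
qed

lemma compact_hyperplanes: "compact (hyperplanes :: (real^'n^'n) set)"
proof -
  have "{\<nu>::real^'n. norm \<nu> = 1} = sphere 0 1" by auto
  then show ?thesis
    unfolding hyperplanes_def
    by (metis compact_continuous_image continuous_on_perp_hyperplane compact_sphere)
qed

section \<open>Tangent directions and the derivative of the projection\<close>

text \<open>Since \<open>mat 1 - T\<close> is \<open>outer \<nu> \<nu>\<close>, the product
  collapses to rank one, with \<open>w\<close> the part of \<open>transpose L *v \<nu>\<close>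
  orthogonal to \<open>\<nu>\<close>. This is the argument at which \<open>B_matrix\<close>
  evaluates the differential.\<close>

lemma tangent_part_perp_hyperplane:
  fixes \<nu> :: "real^'n" and L :: "real^'n^'n"
  assumes "norm \<nu> = 1"
  defines "T \<equiv> perp_hyperplane \<nu>"
  defines "w \<equiv> transpose L *v \<nu> - (\<nu> \<bullet> (transpose L *v \<nu>)) *\<^sub>R \<nu>"
  shows "(mat 1 - T) ** L ** T + transpose ((mat 1 - T) ** L ** T) = outer \<nu> w + outer w \<nu>"
proof -
  have "transpose T = T"
    by (simp add: T_def perp_hyperplane_eq[OF assms(1)] outer_def transpose_def vec_eq_iff mat_def)
  then have "(mat 1 - T) ** L ** T = outer \<nu> w"
    using perp_hyperplane_mult_vec[OF assms(1)] assms
    by (simp add: perp_hyperplane_eq outer_mult_matrix)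
  then show ?thesis
    by (simp add: transpose_outer)
qed

text \<open>Composing with \<open>sgn\<close> extends the parametrisation from the sphere to an open
  set, so ordinary derivatives apply. At a unit vector the derivative of \<open>sgn\<close> is the
  projection \<open>w'\<close>, and the product rule does the rest.\<close>

lemma has_derivative_perp_hyperplane_sgn:
  fixes \<nu> :: "real^'n"
  assumes "norm \<nu> = 1"
  defines "w' \<equiv> \<lambda>w. w - (\<nu> \<bullet> w) *\<^sub>R \<nu>"
  shows "((\<lambda>u. perp_hyperplane (sgn u)) has_derivative
    (\<lambda>w. - (outer \<nu> (w' w) + outer (w' w) \<nu>))) (at \<nu>)"
proof -
  have nz: "\<nu> \<noteq> 0" and [simp]: "sgn \<nu> = \<nu>"
    using assms by (auto simp: sgn_div_norm)
  have "((\<lambda>u. inverse (norm u) *\<^sub>R u) has_derivative w') (at \<nu>)"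
    unfolding w'_def
    by (rule derivative_eq_intros has_derivative_norm nz refl | simp add: nz assms inner_commute)+
  then have d: "(sgn has_derivative w') (at \<nu>)"
    by (simp add: sgn_div_norm[abs_def])
  have "((\<lambda>u. mat 1 - outer (sgn u) (sgn u)) has_derivative
    (\<lambda>w. - (outer \<nu> (w' w) + outer (w' w) \<nu>))) (at \<nu>)"
    by (rule derivative_eq_intros bounded_bilinear.FDERIV[OF bounded_bilinear_outer d d] refl | simp)+
  then show ?thesis
    by (rule has_derivative_transform_within_open[where s = "- {0}"])
       (use nz in \<open>auto simp: perp_hyperplane_eq norm_sgn\<close>)
qed

text \<open>A local extension of the joint function is composed with
  \<open>S \<mapsto> (x, S)\<close>. The inclusion \<open>?i\<close> is a bounded operator, so the
  sliced derivative stays continuous in operator norm.\<close>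

lemma C1_on_submanifold_slice:
  fixes f :: "'a::real_normed_vector \<Rightarrow> 'b::real_normed_vector \<Rightarrow> 'c::real_normed_vector"
  assumes "C1_on_submanifold (A \<times> M) (\<lambda>(y, T). f y T)" "x \<in> A"
  shows "C1_on_submanifold M (f x)"
  unfolding C1_on_submanifold_def
proof
  fix T assume "T \<in> M"
  then obtain U g where U: "open U" "(x, T) \<in> U" "C1_on_open U g"
      and eq: "\<forall>q\<in>(A \<times> M) \<inter> U. (\<lambda>(y, T). f y T) q = g q"
    using assms(1)[unfolded C1_on_submanifold_def, rule_format, of "(x, T)"] assms(2) by blast
  from U(3) obtain g' where
    g': "\<And>p. p \<in> U \<Longrightarrow> (g has_derivative blinfun_apply (g' p)) (at p)" "continuous_on U g'"
    unfolding C1_on_open_def by blast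
  let ?V = "Pair x -` U"
  let ?i = "Blinfun (Pair 0) :: 'b \<Rightarrow>\<^sub>L ('a \<times> 'b)"
  have bl: "bounded_linear (Pair 0 :: 'b \<Rightarrow> 'a \<times> 'b)"
    by (intro bounded_linear_Pair bounded_linear_zero bounded_linear_ident)
  have i: "blinfun_apply ?i = Pair 0"
    by (rule bounded_linear_Blinfun_apply[OF bl])
  have "open ?V"
    by (intro open_vimage U continuous_intros)
  moreover have "((\<lambda>S. g (x, S)) has_derivative blinfun_apply (g' (x, S) o\<^sub>L ?i)) (at S)"
    if "S \<in> ?V" for S
  proof -
    have "((\<lambda>S. (x, S)) has_derivative Pair 0) (at S)"
      by (intro has_derivative_Pair has_derivative_const has_derivative_ident)
    from has_derivative_compose[OF this g'(1)] that
    have "((\<lambda>S. g (x, S)) has_derivative (\<lambda>S'. g' (x, S) (0, S'))) (at S)"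
      by simp
    moreover have "blinfun_apply (g' (x, S) o\<^sub>L ?i) = (\<lambda>S'. g' (x, S) (0, S'))"
      by (simp add: fun_eq_iff i)
    ultimately show ?thesis
      by (simp only:)
  qed
  moreover have "continuous_on ?V (\<lambda>S. g' (x, S) o\<^sub>L ?i)"
    by (intro continuous_intros continuous_on_compose2[OF g'(2)]) auto
  ultimately have "C1_on_open ?V (\<lambda>S. g (x, S))"
    unfolding C1_on_open_def by (intro exI[of _ "\<lambda>S. g' (x, S) o\<^sub>L ?i"] conjI ballI)
  moreover have "\<forall>S\<in>M \<inter> ?V. f x S = g (x, S)"
    using bspec[OF eq] assms(2) by fastforce
  ultimately show "\<exists>U g. open U \<and> T \<in> U \<and> C1_on_open U g \<and> (\<forall>q\<in>M \<inter> U. f x q = g q)"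
    using U(2) \<open>open ?V\<close> by (intro exI[of _ ?V] exI[of _ "\<lambda>S. g (x, S)"]) simp
qed

section \<open>The one-homogeneous integrand at a fixed point\<close>

text \<open>Here \<open>g\<close> stands for \<open>G x\<close>, and \<open>homogeneous\<close> is
  its defining equation.\<close>

locale hyperplane_integrand =
  fixes F :: "real^'n \<Rightarrow> real^'n^'n \<Rightarrow> real" and x :: "real^'n" and g :: "real^'n \<Rightarrow> real"
  assumes C1: "C1_on_submanifold hyperplanes (F x)"
    and pos: "T \<in> hyperplanes \<Longrightarrow> F x T > 0"
    and homogeneous: "norm \<nu> = 1 \<Longrightarrow> g (c *\<^sub>R \<nu>) = \<bar>c\<bar> * F x (perp_hyperplane \<nu>)"
begin

definition B :: "real^'n^'n \<Rightarrow> real^'n^'n" where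
  "B = B_matrix (CARD('n) - 1) F x"

lemma g_eq: "g u = norm u * F x (perp_hyperplane (sgn u))"
proof (cases "u = 0")
  case True
  obtain \<nu> :: "real^'n" where "norm \<nu> = 1" using norm_axis_1 by blast
  with True show ?thesis using homogeneous[of \<nu> 0] by simp
next
  case False
  then show ?thesis
    using homogeneous[of "sgn u" "norm u"] by (simp add: norm_sgn sgn_div_norm)
qed

lemma g_unit: "norm \<nu> = 1 \<Longrightarrow> g \<nu> = F x (perp_hyperplane \<nu>)"
  using homogeneous[of \<nu> 1] by simp

lemma g_unit_pos: "norm \<nu> = 1 \<Longrightarrow> g \<nu> > 0"
  by (simp add: g_unit pos perp_hyperplane_in)

lemma g_uminus: "g (- u) = g u"
  by (cases "u = 0") (simp_all add: g_eq sgn_minus perp_hyperplane_uminus norm_sgn)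

lemma g_scaleR: "g (c *\<^sub>R u) = \<bar>c\<bar> * g u"
proof (cases "u = 0")
  case False
  then have u: "c *\<^sub>R u = (c * norm u) *\<^sub>R sgn u"
    by (simp add: sgn_div_norm)
  show ?thesis
    unfolding u using False homogeneous[of "sgn u" "c * norm u"]
    by (simp add: norm_sgn g_eq abs_mult)
qed (simp add: g_eq)

text \<open>The ambient derivative of a local extension is also a derivative relative to
  \<open>hyperplanes\<close>. Unlike an arbitrary choice of relative derivatives, it varies
  continuously with the plane.\<close>

lemma local_C1_extension:
  assumes "T \<in> hyperplanes"
  obtains U f' where "open U" "T \<in> U" "continuous_on U f'"
    "\<And>S. S \<in> hyperplanes \<inter> U \<Longrightarrow> (F x has_derivative blinfun_apply (f' S)) (at S within hyperplanes)"
proof -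
  obtain U f where U: "open U" "T \<in> U" "C1_on_open U f" and eq: "\<And>q. q \<in> hyperplanes \<inter> U \<Longrightarrow> F x q = f q"
    using C1[unfolded C1_on_submanifold_def, rule_format, OF assms] by auto
  then obtain f' where f': "\<And>p. p \<in> U \<Longrightarrow> (f has_derivative blinfun_apply (f' p)) (at p)" "continuous_on U f'"
    unfolding C1_on_open_def by blast
  have "(F x has_derivative blinfun_apply (f' S)) (at S within hyperplanes)" if S: "S \<in> hyperplanes \<inter> U" for S
  proof -
    have "(f has_derivative blinfun_apply (f' S)) (at S within hyperplanes \<inter> U)"
      using f'(1) S has_derivative_at_withinI by blast
    with S eq have "(F x has_derivative blinfun_apply (f' S)) (at S within hyperplanes \<inter> U)"
      by (intro has_derivative_transform[of S "hyperplanes \<inter> U" "F x" f]) auto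
    then show ?thesis
      using S U(1) by (simp add: at_within_nhd[of S U hyperplanes "hyperplanes \<inter> U"] Int_assoc)
  qed
  with U(1,2) f'(2) show ?thesis using that by blast
qed

lemma differentiable_F:
  assumes "norm \<nu> = 1"
  shows "F x differentiable (at (perp_hyperplane \<nu>) within hyperplanes)"
  using local_C1_extension[OF perp_hyperplane_in[OF assms]] perp_hyperplane_in[OF assms]
  unfolding differentiable_def by (metis IntI)

text \<open>Product and chain rule for \<open>norm u * F x (perp_hyperplane (sgn u))\<close>. The
  relative derivative \<open>D\<close> is left arbitrary, so that different choices can be inserted
  later.\<close>

lemma has_derivative_g_within:
  fixes \<nu> :: "real^'n"
  assumes "norm \<nu> = 1" and D: "(F x has_derivative D) (at (perp_hyperplane \<nu>) within hyperplanes)"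
  defines "w' \<equiv> \<lambda>w. w - (\<nu> \<bullet> w) *\<^sub>R \<nu>"
  shows "(g has_derivative (\<lambda>w. (\<nu> \<bullet> w) * g \<nu> - D (outer \<nu> (w' w) + outer (w' w) \<nu>))) (at \<nu>)"
proof -
  have nz: "\<nu> \<noteq> 0" and [simp]: "sgn \<nu> = \<nu>"
    using assms by (auto simp: sgn_div_norm)
  have lin: "linear D"
    using D has_derivative_linear by blast
  have "((\<lambda>u. perp_hyperplane (sgn u)) has_derivative
    (\<lambda>w. - (outer \<nu> (w' w) + outer (w' w) \<nu>))) (at \<nu> within - {0})"
    unfolding w'_def by (rule has_derivative_at_withinI[OF has_derivative_perp_hyperplane_sgn[OF assms(1)]])
  \<comment> \<open>Away from the origin \<open>sgn u\<close> is a unit vector, so the inner map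
    takes values in \<open>hyperplanes\<close>, the set relative to which \<open>D\<close> is a
    derivative.\<close>
  moreover have "(F x has_derivative D)
      (at (perp_hyperplane (sgn \<nu>)) within (\<lambda>u. perp_hyperplane (sgn u)) ` (- {0}))"
  proof (rule has_derivative_subset)
    show "(F x has_derivative D) (at (perp_hyperplane (sgn \<nu>)) within hyperplanes)"
      using D by simp
    show "(\<lambda>u. perp_hyperplane (sgn u)) ` (- {0}) \<subseteq> hyperplanes"
      by (auto intro!: perp_hyperplane_in simp: norm_sgn split: if_splits)
  qed
  ultimately have "((\<lambda>u. F x (perp_hyperplane (sgn u))) has_derivative
      (\<lambda>w. D (- (outer \<nu> (w' w) + outer (w' w) \<nu>)))) (at \<nu> within - {0})"
    by (rule has_derivative_in_compose)
  then have "((\<lambda>u. F x (perp_hyperplane (sgn u))) has_derivative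
      (\<lambda>w. D (- (outer \<nu> (w' w) + outer (w' w) \<nu>)))) (at \<nu>)"
    using nz by (subst (asm) at_within_open) auto
  from has_derivative_mult[OF has_derivative_norm[OF nz] this]
  have "((\<lambda>u. norm u * F x (perp_hyperplane (sgn u))) has_derivative
      (\<lambda>w. (\<nu> \<bullet> w) * g \<nu> - D (outer \<nu> (w' w) + outer (w' w) \<nu>))) (at \<nu>)"
    by (rule has_derivative_eq_rhs)
       (simp add: assms(1) g_unit fun_eq_iff linear_neg[OF lin] inner_commute del: minus_add_distrib)
  then show ?thesis
    by (simp add: g_eq[abs_def])
qed

text \<open>The Riesz representative of the derivative: the adjoint of a functional into the reals,
  applied to 1.\<close>

definition grad :: "real^'n \<Rightarrow> real^'n" where
  "grad \<nu> = adjoint (frechet_derivative g (at \<nu>)) 1"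

lemma
  assumes "norm \<nu> = 1"
  shows has_derivative_g: "(g has_derivative (\<lambda>w. grad \<nu> \<bullet> w)) (at \<nu>)"
    and frechet_derivative_g: "frechet_derivative g (at \<nu>) = (\<lambda>w. grad \<nu> \<bullet> w)"
proof -
  obtain D where "(F x has_derivative D) (at (perp_hyperplane \<nu>) within hyperplanes)"
    using differentiable_F[OF assms] unfolding differentiable_def by blast
  from has_derivative_g_within[OF assms this] have d: "g differentiable (at \<nu>)"
    unfolding differentiable_def by blast
  have "grad \<nu> \<bullet> w = frechet_derivative g (at \<nu>) w" for w
    unfolding grad_def using adjoint_works[OF linear_frechet_derivative[OF d], of w 1]
    by (simp add: inner_commute)
  then show "frechet_derivative g (at \<nu>) = (\<lambda>w. grad \<nu> \<bullet> w)" by auto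
  with d show "(g has_derivative (\<lambda>w. grad \<nu> \<bullet> w)) (at \<nu>)"
    by (metis frechet_derivative_works)
qed

text \<open>Derivatives of \<open>g\<close> at \<open>\<nu>\<close> are unique. Hence all choices of
  \<open>D\<close> agree on the tangent space.\<close>

lemma grad_inner_within:
  assumes "norm \<nu> = 1" and "(F x has_derivative D) (at (perp_hyperplane \<nu>) within hyperplanes)"
  defines "w' \<equiv> \<lambda>w. w - (\<nu> \<bullet> w) *\<^sub>R \<nu>"
  shows "grad \<nu> \<bullet> w = (\<nu> \<bullet> w) * g \<nu> - D (outer \<nu> (w' w) + outer (w' w) \<nu>)"
  using has_derivative_unique[OF has_derivative_g[OF assms(1)] has_derivative_g_within[OF assms(1,2)]]
  unfolding w'_def by metis

text \<open>Euler's identity for a one-homogeneous function; in the direction \<open>\<nu>\<close>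
  the tangential part vanishes.\<close>

lemma grad_inner_self:
  assumes "norm \<nu> = 1"
  shows "grad \<nu> \<bullet> \<nu> = g \<nu>"
proof -
  obtain D where D: "(F x has_derivative D) (at (perp_hyperplane \<nu>) within hyperplanes)"
    using differentiable_F[OF assms] unfolding differentiable_def by blast
  have "D 0 = 0"
    using D has_derivative_linear linear_0 by blast
  then show ?thesis
    using grad_inner_within[OF assms D, of \<nu>] assms by (simp add: dot_square_norm outer_def zero_vec_def[symmetric])
qed

section \<open>The matrix \<open>B\<close> in terms of the gradient, and its continuity\<close>

text \<open>The left side is the defining expression of \<open>B_matrix\<close> with an arbitrary
  relative derivative \<open>D\<close>. Rewriting the \<open>D\<close> term through
  \<open>grad\<close> produces \<open>(\<nu> \<bullet> ?z) * g \<nu>\<close>, which cancels the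
  deficit of \<open>T \<bullet> L\<close> against the trace of \<open>L\<close>.\<close>

lemma B_pairing:
  assumes \<nu>: "norm \<nu> = 1" and T: "T = perp_hyperplane \<nu>"
    and D: "(F x has_derivative D) (at T within hyperplanes)"
  shows "F x T * (T \<bullet> L) + D ((mat 1 - T) ** L ** T + transpose ((mat 1 - T) ** L ** T))
    = (g \<nu> *\<^sub>R mat 1 - outer \<nu> (grad \<nu>)) \<bullet> L"
proof -
  let ?z = "transpose L *v \<nu>"
  let ?w = "?z - (\<nu> \<bullet> ?z) *\<^sub>R \<nu>"
  have "outer \<nu> (grad \<nu>) \<bullet> L = grad \<nu> \<bullet> ?z"
    by (metis inner_outer inner_matrix_vector inner_commute)
  also have "\<dots> = (\<nu> \<bullet> ?z) * g \<nu> - D (outer \<nu> ?w + outer ?w \<nu>)"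
    using grad_inner_within[OF \<nu>] D T by simp
  finally have "outer \<nu> (grad \<nu>) \<bullet> L = (\<nu> \<bullet> ?z) * g \<nu> - D (outer \<nu> ?w + outer ?w \<nu>)" .
  moreover have "T \<bullet> L = mat 1 \<bullet> L - \<nu> \<bullet> ?z"
    unfolding T perp_hyperplane_eq[OF \<nu>] inner_diff_left inner_outer
    using inner_matrix_vector[of \<nu> L \<nu>] by (simp only: inner_commute)
  moreover have "F x T = g \<nu>"
    by (simp add: T g_unit[OF \<nu>])
  ultimately show ?thesis
    using T by (simp only: tangent_part_perp_hyperplane[OF \<nu>] inner_diff_left inner_scaleR_left)
       (simp only: algebra_simps)
qed

lemma B_perp_hyperplane:
  assumes \<nu>: "norm \<nu> = 1"
  shows "B (perp_hyperplane \<nu>) = g \<nu> *\<^sub>R mat 1 - outer \<nu> (grad \<nu>)"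
proof -
  let ?T = "perp_hyperplane \<nu>"
  have "(F x has_derivative grass_differential (CARD('n) - 1) (F x) ?T) (at ?T within hyperplanes)"
    unfolding grass_differential_def grassmannian_eq_hyperplanes
    using differentiable_F[OF \<nu>] by (simp add: frechet_derivative_works)
  note pairing = B_pairing[OF \<nu> refl this]
  show ?thesis
    unfolding B_def B_matrix_def pairing by (rule the_equality) (simp_all add: vector_eq_rdot)
qed

lemma B_mult_vec:
  "norm \<nu> = 1 \<Longrightarrow>
    B (perp_hyperplane \<nu>) *v w = g \<nu> *\<^sub>R w - (grad \<nu> \<bullet> w) *\<^sub>R \<nu>"
  by (simp add: B_perp_hyperplane matrix_vector_mult_diff_rdistrib outer_mult_vec
      scaleR_matrix_vector_assoc[symmetric])

text \<open>The derivative selected in \<open>grass_differential\<close> need not depend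
  continuously on the plane. By \<open>B_pairing\<close> it may be replaced near \<open>T\<close> by
  the continuous \<open>f'\<close>, which makes every coordinate of \<open>B\<close>
  continuous.\<close>

lemma continuous_on_B:
  "continuous_on hyperplanes B"
  unfolding continuous_on_eq_continuous_within
proof
  fix T :: "real^'n^'n"
  assume T: "T \<in> hyperplanes"
  obtain U f' where U: "open U" "T \<in> U" "continuous_on U f'"
    and f': "\<And>S. S \<in> hyperplanes \<inter> U \<Longrightarrow> (F x has_derivative blinfun_apply (f' S)) (at S within hyperplanes)"
    using local_C1_extension[OF T] by blast
  have c: "continuous_on (hyperplanes \<inter> U) (F x)"
    unfolding continuous_on_eq_continuous_within
    by (blast intro: has_derivative_continuous has_derivative_subset f')
  have m: "continuous_on A (\<lambda>S. (mat 1 - S) ** L ** S + transpose ((mat 1 - S) ** L ** S))"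
    for A and L :: "real^'n^'n"
    unfolding matrix_matrix_mult_def transpose_def by (intro continuous_intros continuous_on_vec_lambda)
  have B_eq: "B S \<bullet> L =
      F x S * (S \<bullet> L) + f' S ((mat 1 - S) ** L ** S + transpose ((mat 1 - S) ** L ** S))"
    if S: "S \<in> hyperplanes \<inter> U" for S L
  proof -
    obtain \<nu> where "norm \<nu> = 1" "S = perp_hyperplane \<nu>"
      using S by (auto elim: hyperplanes_cases)
    with B_pairing[OF this f'[OF S]] show ?thesis
      by (simp only: B_perp_hyperplane)
  qed
  have "continuous_on (hyperplanes \<inter> U) B"
  proof (rule continuous_on_eq)
    show "continuous_on (hyperplanes \<inter> U) (\<lambda>S. \<Sum>L\<in>Basis. (F x S * (S \<bullet> L)
        + f' S ((mat 1 - S) ** L ** S + transpose ((mat 1 - S) ** L ** S))) *\<^sub>R L)"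
      by (intro continuous_intros c m continuous_on_subset[OF U(3)]) auto
    show "(\<Sum>L\<in>Basis. (F x S * (S \<bullet> L)
        + f' S ((mat 1 - S) ** L ** S + transpose ((mat 1 - S) ** L ** S))) *\<^sub>R L) = B S"
      if "S \<in> hyperplanes \<inter> U" for S
      using B_eq[OF that, symmetric] by (simp add: euclidean_representation)
  qed
  then have "continuous (at T within hyperplanes \<inter> U) B"
    using T U(2) by (simp add: continuous_on_eq_continuous_within)
  then show "continuous (at T within hyperplanes) B"
    using U(1,2) by (simp add: at_within_nhd[of T U hyperplanes "hyperplanes \<inter> U"] Int_assoc)
qed


section \<open>Integration against probability measures on the Grassmannian\<close>

lemma borel_measurable_B:
  assumes "sets \<mu> = sets (borel_grassmannian (CARD('n) - 1))"
  shows "B \<in> borel_measurable \<mu>"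
  using borel_measurable_continuous_on_restrict[OF continuous_on_B] assms
  unfolding borel_grassmannian_def grassmannian_eq_hyperplanes
  by (simp cong: measurable_cong_sets)

lemma space_borel_grassmannian:
  "space (borel_grassmannian (CARD('n) - 1)) = (hyperplanes :: (real^'n^'n) set)"
  unfolding borel_grassmannian_def grassmannian_eq_hyperplanes
  by (simp add: space_restrict_space)

lemma singleton_in_borel_grassmannian:
  assumes "T \<in> hyperplanes"
  shows "{T} \<in> sets (borel_grassmannian (CARD('n) - 1) :: (real^'n^'n) measure)"
  using assms unfolding borel_grassmannian_def grassmannian_eq_hyperplanes sets_restrict_space
  by (auto intro!: image_eqI[of _ _ "{T}"])

lemma grass_probs_space:
  assumes "\<mu> \<in> grass_probs (CARD('n) - 1)"
  shows "space \<mu> = (hyperplanes :: (real^'n^'n) set)"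
  using assms sets_eq_imp_space_eq[of \<mu>] unfolding space_borel_grassmannian[symmetric] grass_probs_def
  by blast

text \<open>A continuous function on a compact set is bounded, and the measure is finite.\<close>

lemma integrable_B:
  assumes \<mu>: "\<mu> \<in> grass_probs (CARD('n) - 1)"
  shows "integrable \<mu> B"
proof -
  interpret prob_space \<mu>
    using \<mu> by (simp add: grass_probs_def)
  have "bounded (B ` hyperplanes)"
    using compact_continuous_image[OF continuous_on_B compact_hyperplanes] by (rule compact_imp_bounded)
  then obtain K where "\<And>T. T \<in> hyperplanes \<Longrightarrow> norm (B T) \<le> K"
    unfolding bounded_iff by auto
  then show ?thesis
    using borel_measurable_B \<mu> grass_probs_space[OF \<mu>]
    by (intro integrable_const_bound[of _ K]) (auto simp: grass_probs_def)
qed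

lemma bounded_linear_inner_mult_vec: "bounded_linear (\<lambda>M::real^'n^'n. a \<bullet> (M *v v))"
  by (auto intro!: linearI simp: linear_conv_bounded_linear[symmetric] algebra_simps
      scaleR_matrix_vector_assoc[symmetric])

text \<open>Bounded linear functionals commute with the integral, which reduces statements about the
  kernel to scalar integrals.\<close>

lemma inner_A_matrix:
  assumes "\<mu> \<in> grass_probs (CARD('n) - 1)"
  shows "integrable \<mu> (\<lambda>T. a \<bullet> (B T *v v))"
    and "a \<bullet> (A_matrix (CARD('n) - 1) F x \<mu> *v v) = (\<integral>T. a \<bullet> (B T *v v) \<partial>\<mu>)"
  using integrable_bounded_linear[OF bounded_linear_inner_mult_vec integrable_B[OF assms]]
    integral_bounded_linear[OF bounded_linear_inner_mult_vec integrable_B[OF assms]]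
  by (simp_all add: A_matrix_def B_def)

lemma A_matrix_return:
  assumes "T \<in> hyperplanes"
  shows "A_matrix (CARD('n) - 1) F x (return (borel_grassmannian (CARD('n) - 1)) T) = B T"
  unfolding A_matrix_def B_def[symmetric]
  using assms by (intro integral_return borel_measurable_B refl) (simp only: space_borel_grassmannian)

section \<open>Strict convexity implies the atomic condition\<close>

text \<open>Because \<open>g\<close> is even, strict convexity can be used for both \<open>v\<close>
  and \<open>- v\<close>, which yields the absolute value.\<close>

lemma grad_inner_less:
  assumes sc: "strictly_convex_homogeneous g"
    and \<nu>: "norm \<nu> = 1" "norm v = 1" "v \<noteq> \<nu>" "v \<noteq> - \<nu>"
  shows "\<bar>grad \<nu> \<bullet> v\<bar> < g v"
proof -
  have "grad \<nu> \<bullet> u < g u" if "norm u = 1" "u \<noteq> \<nu>" "u \<noteq> - \<nu>" for u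
    using sc \<nu>(1) that unfolding strictly_convex_homogeneous_def
    by (metis frechet_derivative_g)
  from this[of v] this[of "- v"] show ?thesis
    using \<nu> by (auto simp: g_uminus abs_less_iff minus_equation_iff)
qed

text \<open>The previous bound is used twice, with the roles of \<open>\<nu>\<close> and
  \<open>v\<close> exchanged, and the absolute values are multiplied.\<close>

lemma grad_prod_less:
  assumes sc: "strictly_convex_homogeneous g"
    and \<nu>: "norm \<nu> = 1" "norm v = 1" "v \<noteq> \<nu>" "v \<noteq> - \<nu>"
  shows "(grad \<nu> \<bullet> v) * (grad v \<bullet> \<nu>) < g \<nu> * g v"
proof -
  have "\<bar>grad \<nu> \<bullet> v\<bar> < g v" "\<bar>grad v \<bullet> \<nu>\<bar> < g \<nu>"
    using grad_inner_less[OF sc \<nu>] grad_inner_less[OF sc \<nu>(2,1)] \<nu>(3,4)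
      minus_equation_iff[of v \<nu>] by auto
  then have "\<bar>grad \<nu> \<bullet> v\<bar> * \<bar>grad v \<bullet> \<nu>\<bar> < g v * g \<nu>"
    by (intro mult_strict_mono') auto
  then show ?thesis
    by (simp add: abs_mult[symmetric] mult.commute)
qed

lemma kernel_imp_return:
  assumes sc: "strictly_convex_homogeneous g"
    and \<mu>: "\<mu> \<in> grass_probs (CARD('n) - 1)"
    and v: "norm v = 1" and ker: "A_matrix (CARD('n) - 1) F x \<mu> *v v = 0"
  shows "\<mu> = return (borel_grassmannian (CARD('n) - 1)) (perp_hyperplane v)"
proof -
  interpret prob_space \<mu>
    using \<mu> by (simp add: grass_probs_def)
  \<comment> \<open>Testing against \<open>grad v\<close> makes the integrand symmetric in
    \<open>\<nu>\<close> and \<open>v\<close>, by Euler's identity at \<open>v\<close>.\<close>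
  let ?h = "\<lambda>T. grad v \<bullet> (B T *v v)"
  have h: "?h (perp_hyperplane \<nu>) = g \<nu> * g v - (grad \<nu> \<bullet> v) * (grad v \<bullet> \<nu>)" if "norm \<nu> = 1" for \<nu>
    using that v by (simp add: B_mult_vec inner_diff_right grad_inner_self)
  have h_nonneg: "0 \<le> ?h T \<and> (?h T = 0 \<longrightarrow> T = perp_hyperplane v)" if T: "T \<in> hyperplanes" for T
  proof -
    obtain \<nu> where \<nu>: "norm \<nu> = 1" "T = perp_hyperplane \<nu>"
      using T hyperplanes_cases by blast
    show ?thesis
    proof (cases "v = \<nu> \<or> v = - \<nu>")
      case True
      then have T: "T = perp_hyperplane v"
        using \<nu> by (auto simp: perp_hyperplane_uminus)
      show ?thesis
        unfolding T h[OF v] using v by (simp add: grad_inner_self)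
    next
      case False
      then show ?thesis
        using h[OF \<nu>(1)] grad_prod_less[OF sc \<nu>(1) v] \<nu>(2) by simp
    qed
  qed
  have "(\<integral>T. ?h T \<partial>\<mu>) = 0"
    using inner_A_matrix(2)[OF \<mu>, of "grad v" v] ker by simp
  moreover have "AE T in \<mu>. 0 \<le> ?h T"
    using h_nonneg grass_probs_space[OF \<mu>] by (intro AE_I2) auto
  \<comment> \<open>A nonnegative function with zero integral vanishes almost everywhere, and the
    zero set of \<open>?h\<close> is one point.\<close>
  ultimately have "AE T in \<mu>. ?h T = 0"
    using integral_nonneg_eq_0_iff_AE[OF inner_A_matrix(1)[OF \<mu>]] by blast
  then have ae: "AE T in \<mu>. T = perp_hyperplane v"
    using h_nonneg grass_probs_space[OF \<mu>] by (auto elim: AE_mp)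
  show ?thesis
  proof (rule measure_eqI)
    show "sets \<mu> = sets (return (borel_grassmannian (CARD('n) - 1)) (perp_hyperplane v))"
      using \<mu> by (simp add: grass_probs_def)
    fix X assume X: "X \<in> sets \<mu>"
    have "emeasure \<mu> X = indicator X (perp_hyperplane v)"
    proof (cases "perp_hyperplane v \<in> X")
      case True
      then have "AE T in \<mu>. T \<in> X"
        using ae by (auto elim: AE_mp)
      then show ?thesis
        using True X by (simp add: emeasure_eq_1_AE)
    next
      case False
      then have "AE T in \<mu>. T \<notin> X"
        using ae by (auto elim: AE_mp)
      then have "emeasure \<mu> X = 0"
        using X AE_iff_measurable[of X \<mu> "\<lambda>T. T \<notin> X"] sets.sets_into_space[OF X] by auto
      then show ?thesis
        using False by simp
    qed
    also have "\<dots> = emeasure (return (borel_grassmannian (CARD('n) - 1)) (perp_hyperplane v)) X"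
      using X \<mu> by (subst emeasure_return) (auto simp: grass_probs_def)
    finally show "emeasure \<mu> X = \<dots>" .
  qed
qed

text \<open>On the kernel \<open>g \<nu> *\<^sub>R w\<close> is a multiple of \<open>\<nu>\<close>,
  and \<open>g \<nu>\<close> is positive.\<close>

lemma kernel_B_subset:
  assumes "norm \<nu> = 1"
  shows "matrix_kernel (B (perp_hyperplane \<nu>)) \<subseteq> span {\<nu>}"
proof
  fix w assume "w \<in> matrix_kernel (B (perp_hyperplane \<nu>))"
  then have "g \<nu> *\<^sub>R w = (grad \<nu> \<bullet> w) *\<^sub>R \<nu>"
    using assms by (simp add: matrix_kernel_def B_mult_vec)
  then have "w = ((grad \<nu> \<bullet> w) / g \<nu>) *\<^sub>R \<nu>"
    using g_unit_pos[OF assms]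
    by (metis divide_inverse_commute less_irrefl real_vector_affinity_eq scaleR_scaleR vector_fraction_eq_iff)
  then show "w \<in> span {\<nu>}"
    by (metis span_base span_scale singletonI)
qed

lemma strictly_convex_imp_atomic:
  assumes sc: "strictly_convex_homogeneous g"
  shows "atomic_condition (CARD('n) - 1) F x"
proof -
  have dim_ker: "dim (matrix_kernel (A_matrix (CARD('n) - 1) F x \<mu>)) \<le> 1 \<and>
      (dim (matrix_kernel (A_matrix (CARD('n) - 1) F x \<mu>)) = 1 \<longrightarrow>
        (\<exists>T\<in>hyperplanes. \<mu> = return (borel_grassmannian (CARD('n) - 1)) T))" (is "dim ?K \<le> 1 \<and> _")
    if \<mu>: "\<mu> \<in> grass_probs (CARD('n) - 1)" for \<mu>
  proof (cases "?K \<subseteq> {0}")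
    case True
    then have K: "dim ?K = 0"
      by (simp only: dim_eq_0)
    show ?thesis
      unfolding K by simp
  next
    case False
    then obtain u where u: "u \<in> ?K" "u \<noteq> 0" by blast
    let ?v = "sgn u"
    have v: "norm ?v = 1" and Av: "A_matrix (CARD('n) - 1) F x \<mu> *v ?v = 0"
      using u by (simp_all add: norm_sgn sgn_div_norm matrix_kernel_def matrix_vector_mult_scaleR)
    note eq = kernel_imp_return[OF sc \<mu> v Av]
    \<comment> \<open>A kernel vector already makes \<open>\<mu>\<close> a Dirac mass, so the
      averaged matrix is a single \<open>B\<close>, whose kernel is at most a line.\<close>
    have "?K \<subseteq> span {?v}"
      using kernel_B_subset[OF v] A_matrix_return[OF perp_hyperplane_in[OF v]] eq by metis
    then have "dim ?K \<le> card {?v}"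
      by (intro dim_le_card) auto
    then show ?thesis
      using eq perp_hyperplane_in[OF v] by auto
  qed
  have card: "CARD('n) - (CARD('n) - 1) = 1"
    using zero_less_card_finite[where 'a = 'n] by linarith
  show ?thesis
    unfolding atomic_condition_def card grassmannian_eq_hyperplanes using dim_ker by blast
qed

section \<open>The atomic condition implies strict convexity\<close>

text \<open>The gradients are parallel at a maximiser \<open>u\<close> of \<open>(grad \<nu> \<bullet> u) / g u\<close>. If the maximum is 1,
  it is also attained at \<open>\<nu>\<close>, and the point where strict convexity fails serves as \<open>u\<close>.\<close>

lemma not_strictly_convex_imp_parallel_grad:
  assumes "\<not> strictly_convex_homogeneous g"
  obtains \<nu> u M where "norm \<nu> = 1" "norm u = 1" "u \<noteq> \<nu>" "u \<noteq> - \<nu>" "grad \<nu> = M *\<^sub>R grad u"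
proof -
  obtain \<nu> w where \<nu>: "norm \<nu> = 1" and w: "norm w = 1" "w \<noteq> \<nu>" "w \<noteq> - \<nu>" "g w \<le> grad \<nu> \<bullet> w"
    using assms frechet_derivative_g unfolding strictly_convex_homogeneous_def by (metis not_less)
  let ?r = "\<lambda>u. (grad \<nu> \<bullet> u) / g u"
  have S: "u \<in> sphere 0 1 \<longleftrightarrow> norm u = 1" for u :: "real^'n" by simp
  have "continuous_on (sphere 0 1) g"
    unfolding continuous_on_eq_continuous_within
    by (auto intro!: has_derivative_continuous[OF has_derivative_at_withinI] has_derivative_g)
  then have "continuous_on (sphere 0 1) ?r"
    by (intro continuous_intros) (use g_unit_pos in force)+
  then obtain u0 where u0: "norm u0 = 1" "\<And>u. norm u = 1 \<Longrightarrow> ?r u \<le> ?r u0"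
    using continuous_attains_sup[of "sphere 0 1" ?r] \<nu> by (auto simp: S)
  have "1 \<le> ?r w"
    using w g_unit_pos[of w] by simp
  obtain u where u: "norm u = 1" "u \<noteq> \<nu>" "u \<noteq> - \<nu>" "\<And>u'. norm u' = 1 \<Longrightarrow> ?r u' \<le> ?r u"
  proof (cases "u0 = \<nu> \<or> u0 = - \<nu>")
    case True
    then have "?r u0 \<le> 1"
      using \<nu> g_unit_pos[OF \<nu>] by (auto simp: grad_inner_self g_uminus)
    with \<open>1 \<le> ?r w\<close> that[of w] w u0 show ?thesis
      by (meson order_trans)
  next
    case False
    with that[of u0] u0 show ?thesis by blast
  qed
  let ?M = "?r u"
  \<comment> \<open>Homogeneity carries the maximality of the ratio from the sphere to all vectors,
    so the minimum at \<open>u\<close> below is unconstrained and the full derivative vanishes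
    there.\<close>
  have le: "grad \<nu> \<bullet> y \<le> ?M * g y" for y
  proof (cases "y = 0")
    case True
    then show ?thesis by (simp add: g_eq)
  next
    case False
    then have s: "norm (sgn y) = 1" and y: "y = norm y *\<^sub>R sgn y"
      by (simp_all add: norm_sgn sgn_div_norm)
    have "grad \<nu> \<bullet> sgn y \<le> ?M * g (sgn y)"
      using u(4)[OF s] g_unit_pos[OF s] by (simp add: pos_divide_le_eq)
    then have "norm y * (grad \<nu> \<bullet> sgn y) \<le> norm y * (?M * g (sgn y))"
      by (rule mult_left_mono) simp
    then show ?thesis
      by (subst (1 2) y) (simp add: g_scaleR del: sgn_div_norm, simp add: mult_ac)
  qed
  have "((\<lambda>y. ?M * g y - grad \<nu> \<bullet> y) has_derivative (\<lambda>y. ?M * (grad u \<bullet> y) - grad \<nu> \<bullet> y)) (at u)"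
    by (intro derivative_intros has_derivative_g u)
  moreover have "?M * g u - grad \<nu> \<bullet> u = 0"
    using g_unit_pos[OF u(1)] by simp
  ultimately have "(\<lambda>y. ?M * (grad u \<bullet> y) - grad \<nu> \<bullet> y) = (\<lambda>y. 0)"
    using le by (intro has_derivative_local_min[where x = u]) auto
  then have "\<forall>y. grad \<nu> \<bullet> y = (?M *\<^sub>R grad u) \<bullet> y"
    by (simp add: fun_eq_iff)
  then have "grad \<nu> = ?M *\<^sub>R grad u"
    by (simp only: vector_eq_rdot)
  with \<nu> u that show ?thesis by blast
qed

text \<open>The average of two Dirac masses, written as the image of a fair coin so that integrals
  become two-term sums.\<close>

definition two_atoms :: "real^'n^'n \<Rightarrow> real^'n^'n \<Rightarrow> (real^'n^'n) measure" where
  "two_atoms S T = distr (measure_pmf (bernoulli_pmf (1 / 2)))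
    (borel_grassmannian (CARD('n) - 1)) (\<lambda>b. if b then S else T)"

text \<open>The mass 1/2 of a singleton serves to show that the measure is not Dirac.\<close>

lemma
  assumes S: "S \<in> hyperplanes" and T: "T \<in> hyperplanes" and ne: "S \<noteq> T"
  shows two_atoms_in: "two_atoms S T \<in> grass_probs (CARD('n) - 1)"
    and measure_two_atoms: "measure (two_atoms S T) {S} = 1 / 2"
    and A_matrix_two_atoms: "A_matrix (CARD('n) - 1) F x (two_atoms S T) = (1 / 2) *\<^sub>R (B S + B T)"
proof -
  let ?p = "bernoulli_pmf (1 / 2)" and ?N = "borel_grassmannian (CARD('n) - 1)"
  let ?f = "\<lambda>b. if b then S else T"
  have f: "?f \<in> measurable (measure_pmf ?p) ?N"
    using S T unfolding space_borel_grassmannian[symmetric] by (auto simp: measurable_def)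
  show "two_atoms S T \<in> grass_probs (CARD('n) - 1)"
    unfolding grass_probs_def two_atoms_def
    using prob_space.prob_space_distr[OF prob_space_measure_pmf f] by simp
  have "{S} \<in> sets ?N"
    by (rule singleton_in_borel_grassmannian[OF S])
  then have "measure (two_atoms S T) {S} = measure (measure_pmf ?p) (?f -` {S})"
    unfolding two_atoms_def by (subst measure_distr[OF f]) auto
  also have "?f -` {S} = {True}"
    using ne by (auto split: if_splits)
  finally show "measure (two_atoms S T) {S} = 1 / 2"
    by (simp add: measure_pmf_single)
  have "A_matrix (CARD('n) - 1) F x (two_atoms S T) = (\<integral>b. B (?f b) \<partial>measure_pmf ?p)"
    unfolding A_matrix_def B_def[symmetric] two_atoms_def
    by (intro integral_distr f borel_measurable_B refl)
  also have "\<dots> = (\<Sum>b\<in>UNIV. pmf ?p b *\<^sub>R B (?f b))"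
    by (intro integral_measure_pmf) auto
  also have "\<dots> = (1 / 2) *\<^sub>R (B S + B T)"
    by (simp add: UNIV_bool scaleR_add_right add.commute)
  finally show "A_matrix (CARD('n) - 1) F x (two_atoms S T) = (1 / 2) *\<^sub>R (B S + B T)" .
qed

lemma atomic_imp_strictly_convex:
  assumes ac: "atomic_condition (CARD('n) - 1) F x"
  shows "strictly_convex_homogeneous g"
proof (rule ccontr)
  assume "\<not> strictly_convex_homogeneous g"
  then obtain \<nu> u M where \<nu>: "norm \<nu> = 1" and u: "norm u = 1" "u \<noteq> \<nu>" "u \<noteq> - \<nu>"
    and M: "grad \<nu> = M *\<^sub>R grad u"
    by (rule not_strictly_convex_imp_parallel_grad)
  let ?S = "perp_hyperplane \<nu>" and ?T = "perp_hyperplane u"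
  let ?\<mu> = "two_atoms ?S ?T"
  let ?K = "matrix_kernel (A_matrix (CARD('n) - 1) F x ?\<mu>)"
  have ST: "?S \<in> hyperplanes" "?T \<in> hyperplanes" "?S \<noteq> ?T"
    using \<nu> u perp_hyperplane_in perp_hyperplane_eqD[OF u(1) \<nu>] by auto
  \<comment> \<open>Euler's identity gives \<open>grad u \<bullet> ?v = g \<nu> + g u\<close>, and
    \<open>grad \<nu> \<bullet> ?v\<close> is \<open>M\<close> times this. The two images therefore
    add up to \<open>g \<nu> + g u\<close> times \<open>?v - M *\<^sub>R \<nu> - u\<close>, which is
    zero.\<close>
  let ?v = "M *\<^sub>R \<nu> + u"
  have g\<nu>: "g \<nu> = M * (grad u \<bullet> \<nu>)"
    using grad_inner_self[OF \<nu>] M by simp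
  have "?v \<noteq> 0"
  proof
    assume "?v = 0"
    then have uM: "u = (- M) *\<^sub>R \<nu>"
      by (simp add: add_eq_0_iff)
    then have "\<bar>M\<bar> = 1"
      using u(1) \<nu> by (metis abs_minus_cancel mult.right_neutral norm_scaleR)
    then show False
      using uM u(2,3) by (auto simp: abs_if split: if_splits)
  qed
  have "B ?S *v ?v + B ?T *v ?v = 0"
    using M g\<nu> grad_inner_self[OF u(1)]
    by (simp add: B_mult_vec[OF \<nu>] B_mult_vec[OF u(1)] inner_add_right scaleR_add_left scaleR_add_right algebra_simps)
  then have "?v \<in> ?K"
    unfolding matrix_kernel_def A_matrix_two_atoms[OF ST]
    by (simp add: scaleR_matrix_vector_assoc[symmetric] matrix_vector_mult_add_rdistrib)
  with \<open>?v \<noteq> 0\<close> have "dim ?K \<noteq> 0"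
    unfolding dim_eq_0 by blast
  moreover have card: "CARD('n) - (CARD('n) - 1) = 1"
    using zero_less_card_finite[where 'a = 'n] by linarith
  \<comment> \<open>The first clause of the atomic condition bounds the dimension by 1, so the
    second clause becomes applicable.\<close>
  ultimately have "dim ?K = 1"
    using ac two_atoms_in[OF ST] unfolding atomic_condition_def card by (metis le_less less_one)
  then obtain T0 where "T0 \<in> hyperplanes" "?\<mu> = return (borel_grassmannian (CARD('n) - 1)) T0"
    using ac two_atoms_in[OF ST] unfolding atomic_condition_def card grassmannian_eq_hyperplanes by blast
  moreover have "{?S} \<in> sets (borel_grassmannian (CARD('n) - 1))"
    by (rule singleton_in_borel_grassmannian[OF ST(1)])
  \<comment> \<open>A Dirac mass gives every measurable set measure 0 or 1, never 1/2.\<close>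
  ultimately have "measure ?\<mu> {?S} = indicator {?S} T0"
    by (simp only: measure_return)
  then show False
    unfolding measure_two_atoms[OF ST] by (cases "T0 = ?S") simp_all
qed

end

theorem theorem1p3:
  fixes \<Omega> :: "(real^'n) set"
    and F :: "real^'n \<Rightarrow> real^'n^'n \<Rightarrow> real"
    and G :: "real^'n \<Rightarrow> real^'n \<Rightarrow> real"
    and x :: "real^'n"
  assumes n: "CARD('n) \<ge> 2"
    and Omega: "open \<Omega>"
    and F_C1: "C1_on_submanifold (\<Omega> \<times> grassmannian (CARD('n) - 1)) (\<lambda>(y, T). F y T)"
    and F_pos: "\<And>y T. y \<in> \<Omega> \<Longrightarrow> T \<in> grassmannian (CARD('n) - 1) \<Longrightarrow> F y T > 0"
    and x: "x \<in> \<Omega>"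
    and G: "\<And>(c::real) \<nu>. norm \<nu> = 1 \<Longrightarrow> G x (c *\<^sub>R \<nu>) = \<bar>c\<bar> * F x (perp_hyperplane \<nu>)"
  shows "atomic_condition (CARD('n) - 1) F x \<longleftrightarrow> strictly_convex_homogeneous (G x)"
proof -
  \<comment> \<open>Freezing the first argument at \<open>x\<close> turns joint regularity into
    regularity of \<open>F x\<close> along the hyperplanes.\<close>
  interpret hyperplane_integrand F x "G x"
    by unfold_locales
       (use C1_on_submanifold_slice[OF F_C1 x] F_pos[OF x] G in \<open>auto simp only: grassmannian_eq_hyperplanes\<close>)
  show ?thesis
    using atomic_imp_strictly_convex strictly_convex_imp_atomic by blast
qed

end
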